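(* Let $(\mathcal{S},p)$ be a body framework in $\mathbb{R}^2$ with spatial symmetry group $\mathcal{G}$. Then the representation character lists satisfy $$[\rho_{mech}]-[\rho_{st}]=[\rho_{sp}^{+}]\cdot[\rho_{body}]+[\rho_{sp}]\cdot[\rho_{pin}]-[\rho_{codom}]-[\rho_{rig}],$$ where $[\rho]$ denotes the list of traces $(\operatorname{trace}\rho(g))_{g\in\mathcal{G}}$ and $\cdot$ is the entrywise product.
   Context: A (pin-jointed) body framework in $\mathbb{R}^2$ is a pair $(\mathcal{S},p)$ where $p=\{p_1,\dots,p_r\}$ is a finite set of points of $\mathbb{R}^2$ (pins) and $\mathcal{S}=\{e_1,\dots,e_s\}$ is a collection of subsets of the points (bodies) such that every point is in at least two of the sets and every set contains at least two points. For a body $e$, its centroid is $p_e=\frac{1}{|e|}\sum_{p_i\in e}p_i$. The domain space is $\mathcal{H}_{dom}=(\mathbb{R}^s\otimes\mathbb{R}^3)\oplus(\mathbb{R}^r\otimes\mathbb{R}^2)$, whose vectors are assignments of body velocities $(v_e(x),v_e(y),a_e)\in\mathbb{R}^3$ to bodies $e$ and velocities $u_i=(u_i(x),u_i(y))\in\mathbb{R}^2$ to pins $p_i$. The codomain space is $\mathcal{H}_{codom}=\mathbb{R}^{c}\otimes\mathbb{R}^2$, one copy of $\mathbb{R}^2$ for each of the $c$ membership pairs $(p_i,e)$ with $p_i\in e$ (edges of the bipartite point-body graph). Both carry standard inner products. The rigidity matrix is the linear map $R=R(\mathcal{S},p):\mathcal{H}_{dom}\to\mathcal{H}_{codom}$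 whose component at the pair $(p_i,e)$ is $$\bigl(u_i(x)-v_e(x)+a_e(p_i(y)-p_e(y)),\;\; u_i(y)-v_e(y)-a_e(p_i(x)-p_e(x))\bigr),$$ so that $\ker R$ is the space of infinitesimal flexes, i.e. solutions of $u_i=v_e+a_e(p_i-p_e)^{\pi/2}$ for all $p_i\in e$, where $(x,y)^{\pi/2}=(-y,x)$. The spatial symmetry group $\mathcal{G}$ is the group of isometries $T$ of $\mathbb{R}^2$ with $Tp_i=p_{\pi(i)}$ for some permutation $\pi$ of the pins which respects bodies: $\pi(e_j)=e_{\tau(j)}$ for some permutation $\tau$ of the bodies. For $g=T\in\mathcal{G}$: $\rho_{sp}(g)\in O(2)$ is the linear part of $T$; $\rho_{sp}^{+}=\rho_{sp}\oplus\Delta$ on $\mathbb{R}^3$ with $\Delta(g)=\det\rho_{sp}(g)$; $\rho_{pin}$ on $\mathbb{R}^r$, $\rho_{body}$ on $\mathbb{R}^s$ and $\rho_{mem}$ on $\mathbb{R}^c$ are the permutation representations on pins (via $\pi$), on bodies (via $\tau$) and on membership pairs. Set $\rho_{dom}=(\rho_{body}\otimes\rho_{sp}^{+})\oplus(\rho_{pin}\otimes\rho_{sp})$ on $\mathcal{H}_{dom}$ and $\rho_{codom}=\rho_{mem}\otimes\rho_{sp}$ on $\mathcal{H}_{codom}$. $\mathcal{H}_{rig}\subseteq\ker R$ is the three-dimensional space of trivial (rigid body motion) flexes, i.e. $u_i=b+\omega p_i^{\pi/2}$, $v_e=b+\omega p_e^{\pi/2}$, $a_e=\omega$ with $b\in\mathbb{R}^2$,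 $\omega\in\mathbb{R}$; $\mathcal{H}_{mech}=\ker R\ominus\mathcal{H}_{rig}$ (orthogonal complement in $\ker R$); $\mathcal{H}_{st}=\operatorname{coker}R=\ker R^{*}\subseteq\mathcal{H}_{codom}$. These are invariant subspaces; $\rho_{rig},\rho_{mech}$ are the restrictions of $\rho_{dom}$ to $\mathcal{H}_{rig},\mathcal{H}_{mech}$ and $\rho_{st}$ is the restriction of $\rho_{codom}$ to $\mathcal{H}_{st}$. *)

theory Defs
  imports "HOL-Analysis.Analysis"
begin

section \<open>Linear algebra\<close>

text \<open>The trace of an endomorphism \<open>f\<close> of a finite-dimensional subspace \<open>V\<close>. Only the restriction
  of \<open>f\<close> to \<open>V\<close> enters; the value is meaningful when \<open>f\<close> is linear and \<open>f ` V \<subseteq> V\<close>, in which case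
  it does not depend on the chosen basis.\<close>

definition trace_on :: "'a::real_vector set \<Rightarrow> ('a \<Rightarrow> 'a) \<Rightarrow> real" where
  "trace_on V f =
     (let B = (SOME B. independent B \<and> span B = V)
      in \<Sum>b\<in>B. representation B (f b) b)"

text \<open>\<open>\<real>\<^sup>n \<otimes> \<real>\<^sup>k\<close> is identified with the type \<open>real^'k^'n\<close>: a pure tensor \<open>x \<otimes> y\<close> is the family
  \<open>i \<mapsto> x\<^sub>i y\<close>. The following is the tensor product \<open>A \<otimes> B\<close> of two matrices under this identification,
  so \<open>(A \<otimes> B) (x \<otimes> y) = A x \<otimes> B y\<close>.\<close>

definition tensor_op :: "real^'n^'n \<Rightarrow> real^'k^'k \<Rightarrow> real^'k^'n \<Rightarrow> real^'k^'n" where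
  "tensor_op A B z = (\<chi> i. \<Sum>j\<in>UNIV. A $ i $ j *\<^sub>R (B *v (z $ j)))"

text \<open>The permutation matrix sending the \<open>j\<close>-th basis vector to the \<open>\<sigma> j\<close>-th one.\<close>

definition perm_mat :: "('n \<Rightarrow> 'n) \<Rightarrow> real^'n^'n" where
  "perm_mat \<sigma> = (\<chi> i j. if i = \<sigma> j then 1 else 0)"

definition rot90 :: "real^2 \<Rightarrow> real^2" where
  "rot90 x = vector [- (x $ 2), x $ 1]"


section \<open>Body frameworks\<close>

text \<open>Pins, bodies and membership pairs are enumerated by finite types \<open>'p\<close>, \<open>'b\<close>, \<open>'m\<close>, so that
  \<open>r\<close>, \<open>s\<close>, \<open>c\<close> are their cardinalities: \<open>p i\<close> is the position of the pin \<open>i\<close>, \<open>e j\<close> is the set of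
  (indices of) pins in the body \<open>j\<close>, and \<open>m\<close> enumerates the pairs \<open>(i, j)\<close> with \<open>i \<in> e j\<close>.
  The pins form a set of points and the bodies a set of subsets, hence the two injectivity
  conditions; they also make the permutations induced by a symmetry unique.\<close>

definition body_framework ::
  "('p::finite \<Rightarrow> real^2) \<Rightarrow> ('b::finite \<Rightarrow> 'p set) \<Rightarrow> ('m::finite \<Rightarrow> 'p \<times> 'b) \<Rightarrow> bool" where
  "body_framework p e m \<longleftrightarrow>
     inj p \<and> inj e \<and>
     (\<forall>i. card {j. i \<in> e j} \<ge> 2) \<and>
     (\<forall>j. card (e j) \<ge> 2) \<and>
     bij_betw m UNIV {(i, j). i \<in> e j}"

definition centroid :: "('p::finite \<Rightarrow> real^2) \<Rightarrow> ('b \<Rightarrow> 'p set) \<Rightarrow> 'b \<Rightarrow> real^2" where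
  "centroid p e j = (1 / real (card (e j))) *\<^sub>R (\<Sum>i\<in>e j. p i)"

text \<open>The domain space \<open>(\<real>\<^sup>s \<otimes> \<real>\<^sup>3) \<oplus> (\<real>\<^sup>r \<otimes> \<real>\<^sup>2)\<close>; the components of a body velocity in \<open>\<real>\<^sup>3\<close> are
  \<open>(v(x), v(y), a)\<close>. The codomain space \<open>\<real>\<^sup>c \<otimes> \<real>\<^sup>2\<close> is \<open>real^2^'m\<close>.\<close>

type_synonym ('b, 'p) dom_space = "(real^3^'b) \<times> (real^2^'p)"

definition rigidity_map ::
  "('p::finite \<Rightarrow> real^2) \<Rightarrow> ('b::finite \<Rightarrow> 'p set) \<Rightarrow> ('m::finite \<Rightarrow> 'p \<times> 'b)
     \<Rightarrow> ('b, 'p) dom_space \<Rightarrow> real^2^'m" where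
  "rigidity_map p e m = (\<lambda>(v, u). \<chi> k.
     let i = fst (m k); j = snd (m k); d = p i - centroid p e j
     in vector [u $ i $ 1 - v $ j $ 1 + v $ j $ 3 * d $ 2,
                u $ i $ 2 - v $ j $ 2 - v $ j $ 3 * d $ 1])"

definition H_flex ::
  "('p::finite \<Rightarrow> real^2) \<Rightarrow> ('b::finite \<Rightarrow> 'p set) \<Rightarrow> ('m::finite \<Rightarrow> 'p \<times> 'b)
     \<Rightarrow> ('b, 'p) dom_space set" where
  "H_flex p e m = {z. rigidity_map p e m z = 0}"

definition H_rig ::
  "('p::finite \<Rightarrow> real^2) \<Rightarrow> ('b::finite \<Rightarrow> 'p set) \<Rightarrow> ('b, 'p) dom_space set" where
  "H_rig p e = {(v, u). \<exists>b \<omega>.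
     (\<forall>i. u $ i = b + \<omega> *\<^sub>R rot90 (p i)) \<and>
     (\<forall>j. vector [v $ j $ 1, v $ j $ 2] = b + \<omega> *\<^sub>R rot90 (centroid p e j) \<and> v $ j $ 3 = \<omega>)}"

definition H_mech ::
  "('p::finite \<Rightarrow> real^2) \<Rightarrow> ('b::finite \<Rightarrow> 'p set) \<Rightarrow> ('m::finite \<Rightarrow> 'p \<times> 'b)
     \<Rightarrow> ('b, 'p) dom_space set" where
  "H_mech p e m = H_flex p e m \<inter> orthogonal_comp (H_rig p e)"

definition H_st ::
  "('p::finite \<Rightarrow> real^2) \<Rightarrow> ('b::finite \<Rightarrow> 'p set) \<Rightarrow> ('m::finite \<Rightarrow> 'p \<times> 'b)
     \<Rightarrow> (real^2^'m) set" where
  "H_st p e m = {w. adjoint (rigidity_map p e m) w = 0}"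


section \<open>The spatial symmetry group and its representations\<close>

definition spatial_group ::
  "('p::finite \<Rightarrow> real^2) \<Rightarrow> ('b::finite \<Rightarrow> 'p set) \<Rightarrow> (real^2 \<Rightarrow> real^2) set" where
  "spatial_group p e = {T.
     (\<forall>x y. dist (T x) (T y) = dist x y) \<and>
     (\<exists>\<pi> \<tau>. bij \<pi> \<and> bij \<tau> \<and> (\<forall>i. T (p i) = p (\<pi> i)) \<and> (\<forall>j. \<pi> ` e j = e (\<tau> j)))}"

text \<open>The permutations of pins, bodies and membership pairs induced by a symmetry. They exist for
  members of the spatial group, and are unique because \<open>p\<close>, \<open>e\<close> and \<open>m\<close> are injective.\<close>

definition pin_perm :: "('p::finite \<Rightarrow> real^2) \<Rightarrow> (real^2 \<Rightarrow> real^2) \<Rightarrow> 'p \<Rightarrow> 'p" where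
  "pin_perm p T = (THE \<pi>. \<forall>i. T (p i) = p (\<pi> i))"

definition body_perm ::
  "('p::finite \<Rightarrow> real^2) \<Rightarrow> ('b::finite \<Rightarrow> 'p set) \<Rightarrow> (real^2 \<Rightarrow> real^2) \<Rightarrow> 'b \<Rightarrow> 'b" where
  "body_perm p e T = (THE \<tau>. \<forall>j. pin_perm p T ` e j = e (\<tau> j))"

definition mem_perm ::
  "('p::finite \<Rightarrow> real^2) \<Rightarrow> ('b::finite \<Rightarrow> 'p set) \<Rightarrow> ('m::finite \<Rightarrow> 'p \<times> 'b)
     \<Rightarrow> (real^2 \<Rightarrow> real^2) \<Rightarrow> 'm \<Rightarrow> 'm" where
  "mem_perm p e m T =
     (THE \<mu>. \<forall>k. m (\<mu> k) = (pin_perm p T (fst (m k)), body_perm p e T (snd (m k))))"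

definition rho_sp :: "(real^2 \<Rightarrow> real^2) \<Rightarrow> real^2^2" where
  "rho_sp T = matrix (\<lambda>x. T x - T 0)"

text \<open>The block sum of \<open>rho_sp T\<close> and the \<open>1 \<times> 1\<close> matrix \<open>det (rho_sp T)\<close>.\<close>

definition rho_sp_plus :: "(real^2 \<Rightarrow> real^2) \<Rightarrow> real^3^3" where
  "rho_sp_plus T = (let A = rho_sp T in
     vector [vector [A $ 1 $ 1, A $ 1 $ 2, 0],
             vector [A $ 2 $ 1, A $ 2 $ 2, 0],
             vector [0, 0, det A]])"

definition rho_pin :: "('p::finite \<Rightarrow> real^2) \<Rightarrow> (real^2 \<Rightarrow> real^2) \<Rightarrow> real^'p^'p" where
  "rho_pin p T = perm_mat (pin_perm p T)"

definition rho_body ::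
  "('p::finite \<Rightarrow> real^2) \<Rightarrow> ('b::finite \<Rightarrow> 'p set) \<Rightarrow> (real^2 \<Rightarrow> real^2) \<Rightarrow> real^'b^'b" where
  "rho_body p e T = perm_mat (body_perm p e T)"

definition rho_mem ::
  "('p::finite \<Rightarrow> real^2) \<Rightarrow> ('b::finite \<Rightarrow> 'p set) \<Rightarrow> ('m::finite \<Rightarrow> 'p \<times> 'b)
     \<Rightarrow> (real^2 \<Rightarrow> real^2) \<Rightarrow> real^'m^'m" where
  "rho_mem p e m T = perm_mat (mem_perm p e m T)"

definition rho_dom ::
  "('p::finite \<Rightarrow> real^2) \<Rightarrow> ('b::finite \<Rightarrow> 'p set) \<Rightarrow> (real^2 \<Rightarrow> real^2)
     \<Rightarrow> ('b, 'p) dom_space \<Rightarrow> ('b, 'p) dom_space" where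
  "rho_dom p e T = (\<lambda>(v, u).
     (tensor_op (rho_body p e T) (rho_sp_plus T) v, tensor_op (rho_pin p T) (rho_sp T) u))"

definition rho_codom ::
  "('p::finite \<Rightarrow> real^2) \<Rightarrow> ('b::finite \<Rightarrow> 'p set) \<Rightarrow> ('m::finite \<Rightarrow> 'p \<times> 'b)
     \<Rightarrow> (real^2 \<Rightarrow> real^2) \<Rightarrow> real^2^'m \<Rightarrow> real^2^'m" where
  "rho_codom p e m T = tensor_op (rho_mem p e m T) (rho_sp T)"

end

theory Submission
  imports Defs
begin

text \<open>
  The formula is an equivariant rank-nullity count. Fix a symmetry \<open>T\<close>. It acts on both spaces by
  orthogonal maps, and the rigidity map \<open>R\<close> intertwines the two actions
  (\<open>rigidity_map_equivariant\<close>). Hence the kernel, the image and their orthogonal complements are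
  invariant, and \<open>R\<close> identifies the complement of its kernel with its image. The trace on this common
  part cancels in the difference of the traces on the domain and on the codomain, which leaves the
  trace on \<open>ker R\<close> minus the trace on the cokernel (\<open>trace_on_kernel_minus_cokernel\<close>). The rigid
  motions form an invariant subspace of \<open>ker R\<close> (\<open>rho_dom_H_rig\<close>, \<open>H_rig_subset_H_flex\<close>), so that
  \<open>ker R\<close> contributes the traces on \<open>H_mech\<close> and on \<open>H_rig\<close>. The trace on the domain is read off from
  its tensor product structure, because a trace of a tensor product is the product of the traces
  (\<open>sum_Basis_tensor_op\<close>).

  The geometry enters only through equivariance. A symmetry \<open>T\<close> maps centroids to centroids, and its
  linear part \<open>A\<close> commutes with the quarter turn up to the factor \<open>det A\<close>
  (\<open>orthogonal_matrix_rot90\<close>). This factor is the reason for the summand \<open>det A\<close> in \<open>rho_sp_plus\<close>, by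
  which angular velocities transform.

  The trace on a subspace is defined by an arbitrary basis. The identity \<open>tr (G F) = tr (F G)\<close> for
  maps between two spaces with chosen bases (\<open>sum_representation_commute\<close>) shows both that the basis
  does not matter, so that orthonormal ones can be used, and that isomorphisms preserve traces.
\<close>

section \<open>Traces on invariant subspaces\<close>

text \<open>One row of the identity ``the matrix of a composition is the product of the matrices'', with \<open>G\<close>
  applied to a vector given by its coordinates in \<open>C\<close>.\<close>

lemma representation_linear_image:
  fixes G :: "'b::euclidean_space \<Rightarrow> 'a::euclidean_space"
  assumes B: "independent B" and C: "independent C" and G: "linear G"
    and GC: "G ` span C \<subseteq> span B" and x: "x \<in> span C"
  shows "representation B (G x) b = (\<Sum>c\<in>C. representation C x c * representation B (G c) b)"
proof -
  have fin: "finite C"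
    using C by (rule independent_imp_finite)
  have mem: "G c \<in> span B" if "c \<in> C" for c
    using GC span_base[OF that] by auto
  have "G x = G (\<Sum>c\<in>C. representation C x c *\<^sub>R c)"
    using C x fin by (simp add: real_vector.sum_representation_eq)
  also have "\<dots> = (\<Sum>c\<in>C. representation C x c *\<^sub>R G c)"
    using G by (simp add: linear_sum linear_scale)
  finally show ?thesis
    using B mem by (simp add: real_vector.representation_sum real_vector.representation_scale span_scale)
qed

text \<open>The identity \<open>tr (G F) = tr (F G)\<close> for maps between two possibly different spaces. All that is
  needed about the independence of traces from bases, and about their invariance under isomorphisms,
  is a special case of it.\<close>

lemma sum_representation_commute:
  fixes F :: "'a::euclidean_space \<Rightarrow> 'b::euclidean_space"
  assumes B: "independent B" and C: "independent C" and F: "linear F" and G: "linear G"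
    and FB: "F ` span B \<subseteq> span C" and GC: "G ` span C \<subseteq> span B"
  shows "(\<Sum>b\<in>B. representation B (G (F b)) b) = (\<Sum>c\<in>C. representation C (F (G c)) c)"
proof -
  have "F b \<in> span C" if "b \<in> B" for b
    using FB span_base[OF that] by auto
  then have "(\<Sum>b\<in>B. representation B (G (F b)) b)
      = (\<Sum>b\<in>B. \<Sum>c\<in>C. representation C (F b) c * representation B (G c) b)"
    using representation_linear_image[OF B C G GC] by simp
  also have "\<dots> = (\<Sum>c\<in>C. \<Sum>b\<in>B. representation B (G c) b * representation C (F b) c)"
    by (subst sum.swap) (simp add: mult.commute)
  also have "G c \<in> span B" if "c \<in> C" for c
    using GC span_base[OF that] by auto
  then have "(\<Sum>c\<in>C. \<Sum>b\<in>B. representation B (G c) b * representation C (F b) c)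
      = (\<Sum>c\<in>C. representation C (F (G c)) c)"
    using representation_linear_image[OF C B F FB] by simp
  finally show ?thesis .
qed

text \<open>Traces do not depend on the basis: apply \<open>tr (G F) = tr (F G)\<close> to \<open>f\<close> and the identity, with
  different bases at the two ends.\<close>

lemma trace_on_basis:
  fixes f :: "'a::euclidean_space \<Rightarrow> 'a"
  assumes B: "independent B" "span B = V" and f: "linear f" "f ` V \<subseteq> V"
  shows "trace_on V f = (\<Sum>b\<in>B. representation B (f b) b)"
proof -
  define C where "C = (SOME C. independent C \<and> span C = V)"
  have "\<exists>C. independent C \<and> span C = V"
    using B by blast
  then have C: "independent C" "span C = V"
    unfolding C_def by (metis (mono_tags, lifting) someI_ex)+
  have "(\<Sum>c\<in>C. representation C (id (f c)) c) = (\<Sum>b\<in>B. representation B (f (id b)) b)"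
    using B C f by (intro sum_representation_commute) (auto simp: linear_iff)
  then show ?thesis
    by (simp add: trace_on_def Let_def flip: C_def)
qed

text \<open>In an orthonormal basis the coordinates are inner products, so that each summand depends on
  its basis vector alone and not on the rest of the basis. This is what lets bases be joined.\<close>

lemma trace_on_orthonormal:
  fixes f :: "'a::euclidean_space \<Rightarrow> 'a"
  assumes B: "pairwise orthogonal B" "\<And>b. b \<in> B \<Longrightarrow> norm b = 1" "span B = V"
    and f: "linear f" "f ` V \<subseteq> V"
  shows "trace_on V f = (\<Sum>b\<in>B. f b \<bullet> b)"
proof -
  have ind: "independent B"
    using B by (intro pairwise_orthogonal_independent) force+
  have "representation B (f b) b = f b \<bullet> b" if b: "b \<in> B" for b
  proof -
    have "f b \<in> span B"
      using b B f span_base by blast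
    then have "f b \<bullet> b = (\<Sum>c\<in>B. representation B (f b) c *\<^sub>R c) \<bullet> b"
      using ind independent_imp_finite[OF ind] by (simp add: real_vector.sum_representation_eq)
    also have "\<dots> = (\<Sum>c\<in>B. if c = b then representation B (f b) b else 0)"
      unfolding inner_sum_left
      using B b by (intro sum.cong) (auto simp: pairwise_def orthogonal_def norm_eq_1)
    finally show ?thesis
      using b independent_imp_finite[OF ind] by simp
  qed
  then show ?thesis
    using trace_on_basis[OF ind B(3) f] by simp
qed

lemma trace_on_UNIV:
  fixes f :: "'a::euclidean_space \<Rightarrow> 'a"
  assumes "linear f"
  shows "trace_on UNIV f = (\<Sum>b\<in>Basis. f b \<bullet> b)"
  using assms by (intro trace_on_orthonormal) (auto simp: pairwise_def orthogonal_def inner_not_same_Basis)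

lemma orthogonal_transformation_image_subspace_eq:
  fixes f :: "'a::euclidean_space \<Rightarrow> 'a"
  assumes f: "orthogonal_transformation f" and U: "subspace U" "f ` U \<subseteq> U"
  shows "f ` U = U"
proof (rule subspace_dim_equal)
  have "linear f" "inj f"
    using f orthogonal_transformation_linear orthogonal_transformation_inj by blast+
  then show "subspace (f ` U)" "dim U \<le> dim (f ` U)"
    using U by (auto simp: linear_subspace_image dim_image_eq inj_on_subset)
qed (use U in auto)

text \<open>Inner products of \<open>f x\<close> can only be computed against vectors \<open>f y\<close>. This is enough because an
  injective map of the finite-dimensional \<open>U\<close> into itself is onto \<open>U\<close>.\<close>

lemma orthogonal_transformation_image_orthogonal_comp:
  fixes f :: "'a::euclidean_space \<Rightarrow> 'a"
  assumes f: "orthogonal_transformation f" and U: "subspace U" "f ` U \<subseteq> U"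
  shows "f ` (U\<^sup>\<bottom>) \<subseteq> U\<^sup>\<bottom>"
proof clarify
  fix x assume x: "x \<in> U\<^sup>\<bottom>"
  have "orthogonal z (f x)" if "z \<in> U" for z
  proof -
    obtain y where "y \<in> U" "z = f y"
      using orthogonal_transformation_image_subspace_eq[OF f U] \<open>z \<in> U\<close> by blast
    then show ?thesis
      using f x by (auto simp: orthogonal_comp_def orthogonal_def orthogonal_transformation_def)
  qed
  then show "f x \<in> U\<^sup>\<bottom>"
    by (simp add: orthogonal_comp_def)
qed

text \<open>The union of orthonormal bases of \<open>U\<close> and of its complement in \<open>V\<close> is an orthonormal basis of
  \<open>V\<close>, and in it the sum for the trace splits.\<close>

lemma trace_on_orthogonal_comp:
  fixes f :: "'a::euclidean_space \<Rightarrow> 'a"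
  assumes f: "orthogonal_transformation f"
    and U: "subspace U" "f ` U \<subseteq> U" and V: "subspace V" "f ` V \<subseteq> V" and UV: "U \<subseteq> V"
  shows "trace_on V f = trace_on U f + trace_on (V \<inter> U\<^sup>\<bottom>) f"
proof -
  let ?W = "V \<inter> U\<^sup>\<bottom>"
  have lin: "linear f"
    using f by (rule orthogonal_transformation_linear)
  have W: "subspace ?W" "f ` ?W \<subseteq> ?W"
    using V orthogonal_transformation_image_orthogonal_comp[OF f U]
    by (auto simp: subspace_inter subspace_orthogonal_comp)
  obtain B where B: "pairwise orthogonal B" "\<And>b. b \<in> B \<Longrightarrow> norm b = 1" "span B = U"
      "independent B" "B \<subseteq> U"
    using orthonormal_basis_subspace[OF U(1)] by metis
  obtain C where C: "pairwise orthogonal C" "\<And>b. b \<in> C \<Longrightarrow> norm b = 1" "span C = ?W"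
      "independent C" "C \<subseteq> ?W"
    using orthonormal_basis_subspace[OF W(1)] by metis
  have orth: "orthogonal b c" "orthogonal c b" if "b \<in> B" "c \<in> C" for b c
    using that B(5) C(5) unfolding orthogonal_comp_def
    by (blast, metis (mono_tags, lifting) IntD2 mem_Collect_eq orthogonal_commute subsetD)
  have disj: "B \<inter> C = {}"
    using orth B(2) by (force simp: orthogonal_self)
  have "span (B \<union> C) = V"
  proof
    show "span (B \<union> C) \<subseteq> V"
      using B(5) C(5) UV V by (intro span_minimal) auto
    show "V \<subseteq> span (B \<union> C)"
    proof
      fix x assume x: "x \<in> V"
      obtain u w where uw: "x = u + w" "u \<in> U" "w \<in> U\<^sup>\<bottom>"
        using subspace_sum_orthogonal_comp[OF U(1)] set_plus_elim by (metis UNIV_I)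
      then have "w \<in> ?W"
        using x UV V by (metis IntI add_diff_cancel_left' subsetD subspace_diff)
      then show "x \<in> span (B \<union> C)"
        using uw B(3) C(3) by (auto simp: span_Un)
    qed
  qed
  moreover have "pairwise orthogonal (B \<union> C)"
    using B(1) C(1) orth by (auto simp: pairwise_def)
  ultimately have "trace_on V f = (\<Sum>b\<in>B \<union> C. f b \<bullet> b)"
    using B C V lin by (intro trace_on_orthonormal) auto
  also have "\<dots> = (\<Sum>b\<in>B. f b \<bullet> b) + (\<Sum>b\<in>C. f b \<bullet> b)"
    using disj B(4) C(4) by (intro sum.union_disjoint) (auto intro: independent_imp_finite)
  also have "(\<Sum>b\<in>B. f b \<bullet> b) = trace_on U f"
    using trace_on_orthonormal[OF B(1-3) lin U(2)] by simp
  also have "(\<Sum>b\<in>C. f b \<bullet> b) = trace_on ?W f"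
    using trace_on_orthonormal[OF C(1-3) lin W(2)] by simp
  finally show ?thesis .
qed

text \<open>An equivariant isomorphism \<open>V \<rightarrow> R ` V\<close> preserves traces. If \<open>S\<close> is inverse to \<open>R\<close> on \<open>V\<close>, then
  \<open>(f \<circ> S) \<circ> R = f\<close> on \<open>V\<close> and \<open>R \<circ> (f \<circ> S) = g\<close> on \<open>R ` V\<close>, so that this is
  \<open>tr (G F) = tr (F G)\<close> for \<open>F = R\<close> and \<open>G = f \<circ> S\<close>.\<close>

lemma trace_on_image:
  fixes R :: "'a::euclidean_space \<Rightarrow> 'b::euclidean_space"
  assumes R: "linear R" "inj_on R V" and V: "subspace V" "f ` V \<subseteq> V"
    and f: "linear f" and g: "linear g" and comm: "\<And>x. x \<in> V \<Longrightarrow> R (f x) = g (R x)"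
  shows "trace_on (R ` V) g = trace_on V f"
proof -
  obtain S where S: "linear S" "\<And>x. x \<in> V \<Longrightarrow> S (R x) = x"
    using linear_exists_left_inverse_on[OF R(1) V(1) R(2)] by blast
  obtain B where B: "independent B" "span B = V"
    using basis_exists[of V] V(1) span_subspace by metis
  obtain C where C: "independent C" "span C = R ` V"
    using basis_exists[of "R ` V"] linear_subspace_image[OF R(1) V(1)] span_subspace by metis
  have fV: "f x \<in> V" if "x \<in> V" for x
    using V(2) that by auto
  have BV: "B \<subseteq> V" and CV: "C \<subseteq> R ` V"
    using B C span_superset by blast+
  have "trace_on (R ` V) g = (\<Sum>c\<in>C. representation C (g c) c)"
    using C g fV by (intro trace_on_basis) (auto simp flip: comm)
  also have "\<dots> = (\<Sum>c\<in>C. representation C (R ((f \<circ> S) c)) c)"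
    using CV S(2) comm by (intro sum.cong) (auto simp: subset_iff image_iff)
  also have "\<dots> = (\<Sum>b\<in>B. representation B ((f \<circ> S) (R b)) b)"
    using B C R(1) S f fV by (intro sum_representation_commute[symmetric] linear_compose) auto
  also have "\<dots> = (\<Sum>b\<in>B. representation B (f b) b)"
    using BV S(2) by (intro sum.cong) (auto simp: subset_iff)
  also have "\<dots> = trace_on V f"
    using B f V(2) by (intro trace_on_basis[symmetric])
  finally show ?thesis .
qed

text \<open>The equivariant form of the rank-nullity count (which is the case of identity maps). Both total
  traces contain the trace on the image of \<open>R\<close>: in the codomain it sits next to the cokernel
  \<open>(range R)\<^sup>\<bottom>\<close>, and in the domain \<open>R\<close> carries the complement of the kernel isomorphically onto it.\<close>

lemma trace_on_kernel_minus_cokernel: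
  fixes R :: "'a::euclidean_space \<Rightarrow> 'b::euclidean_space"
  assumes R: "linear R" and f: "orthogonal_transformation f" and g: "orthogonal_transformation g"
    and comm: "\<And>x. R (f x) = g (R x)"
  shows "trace_on {x. R x = 0} f - trace_on {y. adjoint R y = 0} g
           = trace_on UNIV f - trace_on UNIV g"
proof -
  let ?K = "{x. R x = 0}"
  have lin: "linear f" "linear g"
    using f g orthogonal_transformation_linear by blast+
  have K: "subspace ?K" "f ` ?K \<subseteq> ?K"
    using R lin by (auto simp: linear_subspace_kernel comm linear_0)
  have range: "subspace (range R)" "g ` range R \<subseteq> range R"
    using R by (auto simp: linear_subspace_image simp flip: comm)
  have coker: "{y. adjoint R y = 0} = (range R)\<^sup>\<bottom>"
    using ker_orthogonal_comp_adjoint[OF adjoint_linear[OF R]] adjoint_adjoint[OF R]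
    by (auto simp: vimage_def)
  have RK: "R ` (?K\<^sup>\<bottom>) = range R"
  proof -
    have "R x \<in> R ` (?K\<^sup>\<bottom>)" for x
    proof -
      obtain u w where "x = u + w" "u \<in> ?K" "w \<in> ?K\<^sup>\<bottom>"
        using subspace_sum_orthogonal_comp[OF K(1)] set_plus_elim by (metis UNIV_I)
      then show ?thesis
        using R by (auto simp: linear_add)
    qed
    then show ?thesis
      by auto
  qed
  have "inj_on R (?K\<^sup>\<bottom>)"
    using orthogonal_Int_0[OF K(1)]
    by (subst linear_inj_on_iff_eq_0[OF R subspace_orthogonal_comp]) auto
  then have "trace_on (range R) g = trace_on (?K\<^sup>\<bottom>) f"
    using trace_on_image[OF R _ subspace_orthogonal_comp
        orthogonal_transformation_image_orthogonal_comp[OF f K] lin comm] RK by simp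
  moreover have "trace_on UNIV f = trace_on ?K f + trace_on (?K\<^sup>\<bottom>) f"
    using trace_on_orthogonal_comp[OF f K subspace_UNIV] by simp
  moreover have "trace_on UNIV g = trace_on (range R) g + trace_on ((range R)\<^sup>\<bottom>) g"
    using trace_on_orthogonal_comp[OF g range subspace_UNIV] by simp
  ultimately show ?thesis
    using coker by simp
qed

section \<open>Traces and isometries on tensor products\<close>

lemma sum_Basis_vec:
  fixes h :: "real^'k^'n \<Rightarrow> 'a::comm_monoid_add"
  shows "(\<Sum>b\<in>Basis. h b) = (\<Sum>i\<in>UNIV. \<Sum>k\<in>UNIV. h (axis i (axis k 1)))"
proof -
  have "inj (\<lambda>(i::'n, k::'k). axis i (axis k (1::real)))"
    by (auto simp: inj_on_def axis_eq_axis)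
  moreover have "range (\<lambda>(i::'n, k::'k). axis i (axis k (1::real))) = Basis"
    by (auto simp: Basis_vec_def image_iff)
  ultimately have "(\<Sum>b\<in>Basis. h b) = (\<Sum>(i, k)\<in>UNIV. h (axis i (axis k 1)))"
    by (metis (no_types, lifting) split_def sum.reindex_cong)
  then show ?thesis
    by (simp add: sum.cartesian_product)
qed

lemma linear_tensor_op: "linear (tensor_op A B)"
  by (rule linearI)
    (simp_all add: tensor_op_def vec_eq_iff matrix_vector_right_distrib scaleR_add_right sum.distrib
      matrix_vector_mult_scaleR scaleR_sum_right sum_distrib_left mult.left_commute algebra_simps)

text \<open>The left-hand side is the trace of \<open>A \<otimes> B\<close> on the whole space.\<close>

lemma sum_Basis_tensor_op:
  "(\<Sum>b\<in>Basis. tensor_op A B b \<bullet> b) = trace A * trace B"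
proof -
  have "tensor_op A B (axis i (axis k 1)) \<bullet> axis i (axis k 1) = A $ i $ i * B $ k $ k" for i k
  proof -
    have "tensor_op A B (axis i (axis k 1)) $ i
        = (\<Sum>j\<in>UNIV. if j = i then A $ i $ i *\<^sub>R (B *v axis k 1) else 0)"
      unfolding tensor_op_def vec_lambda_beta by (rule sum.cong) (simp_all add: axis_def)
    then show ?thesis
      by (simp add: inner_axis matrix_vector_mul_component)
  qed
  then show ?thesis
    by (simp add: sum_Basis_vec trace_def sum_product)
qed

lemma trace_on_prod:
  fixes f :: "'a::euclidean_space \<Rightarrow> 'a" and g :: "'b::euclidean_space \<Rightarrow> 'b"
  assumes "linear f" "linear g"
  shows "trace_on UNIV (\<lambda>(x, y). (f x, g y)) = (\<Sum>b\<in>Basis. f b \<bullet> b) + (\<Sum>b\<in>Basis. g b \<bullet> b)"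
proof -
  have "linear (\<lambda>(x, y). (f x, g y))"
    using assms by (auto simp: linear_iff)
  then show ?thesis
    unfolding Basis_prod_def
    by (subst trace_on_UNIV, assumption, unfold Basis_prod_def, subst sum.union_disjoint)
      (auto simp: sum.reindex inj_on_def)
qed

text \<open>Evaluating at \<open>\<sigma> j\<close> keeps inverse permutations out of all later computations.\<close>

lemma tensor_op_perm_mat:
  assumes "inj \<sigma>"
  shows "tensor_op (perm_mat \<sigma>) B z $ \<sigma> j = B *v (z $ j)"
proof -
  have "tensor_op (perm_mat \<sigma>) B z $ \<sigma> j = (\<Sum>k\<in>UNIV. if k = j then B *v (z $ j) else 0)"
    unfolding tensor_op_def perm_mat_def vec_lambda_beta
    using assms by (intro sum.cong) (auto simp: inj_eq)
  then show ?thesis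
    by simp
qed

lemma orthogonal_transformation_tensor_op_perm_mat:
  assumes "bij \<sigma>" "orthogonal_transformation ((*v) B)"
  shows "orthogonal_transformation (tensor_op (perm_mat \<sigma>) B)"
proof -
  have "tensor_op (perm_mat \<sigma>) B v \<bullet> tensor_op (perm_mat \<sigma>) B w = v \<bullet> w" for v w
  proof -
    have "tensor_op (perm_mat \<sigma>) B v \<bullet> tensor_op (perm_mat \<sigma>) B w
        = (\<Sum>j\<in>UNIV. tensor_op (perm_mat \<sigma>) B v $ \<sigma> j \<bullet> tensor_op (perm_mat \<sigma>) B w $ \<sigma> j)"
      unfolding inner_vec_def using assms(1) by (rule sum.reindex_bij_betw[symmetric])
    also have "\<dots> = v \<bullet> w"
      using assms(2) bij_is_inj[OF assms(1)]
      by (simp add: tensor_op_perm_mat orthogonal_transformation_def inner_vec_def[of v w])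
    finally show ?thesis .
  qed
  then show ?thesis
    by (simp add: orthogonal_transformation_def linear_tensor_op)
qed

section \<open>Plane geometry of the velocity spaces\<close>

lemma linear_rot90: "linear rot90"
  by (rule linearI) (auto simp: rot90_def vec_eq_iff forall_2)

text \<open>A rotation commutes with the quarter turn, and a reflection reverses its sense. In coordinates,
  an orthogonal matrix is \<open>det A\<close> times its matrix of cofactors.\<close>

lemma orthogonal_matrix_rot90:
  assumes "orthogonal_matrix A"
  shows "A *v rot90 x = det A *\<^sub>R rot90 (A *v x)"
proof -
  have "transpose A ** A = mat 1" "A ** transpose A = mat 1"
    using assms by (auto simp: orthogonal_matrix_def)
  then have orth: "A$1$1 * A$1$1 + A$2$1 * A$2$1 = 1" "A$1$2 * A$1$2 + A$2$2 * A$2$2 = 1"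
      "A$1$1 * A$1$2 + A$2$1 * A$2$2 = 0"
    by (simp_all add: vec_eq_iff forall_2 matrix_matrix_mult_def transpose_def mat_def sum_2)
  have cofactor: "det A * A$1$1 = A$2$2" "det A * A$2$2 = A$1$1"
      "det A * A$1$2 = - A$2$1" "det A * A$2$1 = - A$1$2"
    unfolding det_2 using orth by algebra+
  have "A$1$1 * - x$2 + A$1$2 * x$1 = det A * - (A$2$1 * x$1 + A$2$2 * x$2)"
    "A$2$1 * - x$2 + A$2$2 * x$1 = det A * (A$1$1 * x$1 + A$1$2 * x$2)"
    by (simp_all add: distrib_left right_diff_distrib cofactor flip: mult.assoc)
  then show ?thesis
    by (simp add: vec_eq_iff forall_2 rot90_def matrix_vector_mult_def sum_2)
qed

text \<open>The velocity of the centroid of a body, which \<open>H_rig\<close> and the rigidity map combine with the angular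
  velocity \<open>w $ 3\<close>.\<close>

definition translation_part :: "real^3 \<Rightarrow> real^2" where
  "translation_part w = vector [w $ 1, w $ 2]"

lemma linear_translation_part: "linear translation_part"
  by (rule linearI) (auto simp: translation_part_def vec_eq_iff forall_2)

lemma inner_translation_part: "v \<bullet> w = translation_part v \<bullet> translation_part w + v $ 3 * w $ 3"
  by (simp add: translation_part_def inner_vec_def sum_2 sum_3)

lemma translation_part_rho_sp_plus: "translation_part (rho_sp_plus T *v w) = rho_sp T *v translation_part w"
  by (simp add: translation_part_def rho_sp_plus_def Let_def vec_eq_iff forall_2 matrix_vector_mult_def sum_2 sum_3)

lemma angular_rho_sp_plus: "(rho_sp_plus T *v w) $ 3 = det (rho_sp T) * w $ 3"
  by (simp add: rho_sp_plus_def Let_def matrix_vector_mult_def sum_3)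

text \<open>The vector form \<open>u\<^sub>i - (v\<^sub>j + a\<^sub>j (p\<^sub>i - p\<^sub>e)\<^sup>\<pi>\<^sup>/\<^sup>2)\<close> of the two scalar components, in which the linear
  part of a symmetry can be applied without splitting into coordinates.\<close>

lemma rigidity_map_nth:
  "rigidity_map p e m (v, u) $ k = (let i = fst (m k); j = snd (m k) in
     u $ i - translation_part (v $ j) - v $ j $ 3 *\<^sub>R rot90 (p i - centroid p e j))"
  by (simp add: rigidity_map_def translation_part_def rot90_def Let_def vec_eq_iff forall_2 algebra_simps)

lemma linear_rigidity_map:
  fixes p :: "'p::finite \<Rightarrow> real^2" and e :: "'b::finite \<Rightarrow> 'p set" and m :: "'m::finite \<Rightarrow> 'p \<times> 'b"
  shows "linear (rigidity_map p e m)"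
proof (rule linearI)
  fix x y :: "('b, 'p) dom_space" and c :: real
  show "rigidity_map p e m (x + y) = rigidity_map p e m x + rigidity_map p e m y"
    by (cases x; cases y)
      (simp add: vec_eq_iff[where 'b='m] rigidity_map_nth Let_def
        linear_add[OF linear_translation_part] algebra_simps)
  show "rigidity_map p e m (c *\<^sub>R x) = c *\<^sub>R rigidity_map p e m x"
    by (cases x)
      (simp add: vec_eq_iff[where 'b='m] rigidity_map_nth Let_def
        linear_scale[OF linear_translation_part] algebra_simps)
qed

lemma mem_H_rig_iff:
  "(v, u) \<in> H_rig p e \<longleftrightarrow> (\<exists>b \<omega>. (\<forall>i. u $ i = b + \<omega> *\<^sub>R rot90 (p i)) \<and>
     (\<forall>j. translation_part (v $ j) = b + \<omega> *\<^sub>R rot90 (centroid p e j) \<and> v $ j $ 3 = \<omega>))"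
  by (simp add: H_rig_def translation_part_def)

lemma subspace_H_rig: "subspace (H_rig p e)"
proof (rule subspaceI)
  show "0 \<in> H_rig p e"
    unfolding zero_prod_def mem_H_rig_iff
    by (rule exI[of _ 0], rule exI[of _ 0]) (simp add: linear_0[OF linear_translation_part])
next
  fix x y assume x: "x \<in> H_rig p e" and y: "y \<in> H_rig p e"
  obtain v u v' u' where xy: "x = (v, u)" "y = (v', u')"
    by (cases x; cases y)
  obtain b \<omega> where
    "\<forall>i. u $ i = b + \<omega> *\<^sub>R rot90 (p i)"
    "\<forall>j. translation_part (v $ j) = b + \<omega> *\<^sub>R rot90 (centroid p e j) \<and> v $ j $ 3 = \<omega>"
    using x unfolding xy mem_H_rig_iff by blast
  moreover obtain b' \<omega>' where
    "\<forall>i. u' $ i = b' + \<omega>' *\<^sub>R rot90 (p i)"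
    "\<forall>j. translation_part (v' $ j) = b' + \<omega>' *\<^sub>R rot90 (centroid p e j) \<and> v' $ j $ 3 = \<omega>'"
    using y unfolding xy mem_H_rig_iff by blast
  ultimately show "x + y \<in> H_rig p e"
    unfolding xy mem_H_rig_iff add_Pair
    by (intro exI[of _ "b + b'"] exI[of _ "\<omega> + \<omega>'"])
      (simp add: linear_add[OF linear_translation_part] algebra_simps)
next
  fix c x assume "x \<in> H_rig p e"
  moreover obtain v u where x: "x = (v, u)"
    by (cases x)
  ultimately obtain b \<omega> where
    "\<forall>i. u $ i = b + \<omega> *\<^sub>R rot90 (p i)"
    "\<forall>j. translation_part (v $ j) = b + \<omega> *\<^sub>R rot90 (centroid p e j) \<and> v $ j $ 3 = \<omega>"
    unfolding x mem_H_rig_iff by blast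
  then show "c *\<^sub>R x \<in> H_rig p e"
    unfolding x mem_H_rig_iff scaleR_Pair
    by (intro exI[of _ "c *\<^sub>R b"] exI[of _ "c * \<omega>"])
      (simp add: linear_scale[OF linear_translation_part] algebra_simps)
qed

lemma H_rig_subset_H_flex: "H_rig p e \<subseteq> H_flex p e m"
proof
  fix x assume x: "x \<in> H_rig p e"
  obtain v u where vu: "x = (v, u)"
    by (cases x)
  have "rigidity_map p e m (v, u) $ k = 0" for k
    using x unfolding vu mem_H_rig_iff
    by (auto simp: rigidity_map_nth Let_def
        linear_diff[OF linear_rot90] algebra_simps)
  then show "x \<in> H_flex p e m"
    by (simp add: H_flex_def vu vec_eq_iff[where 'b='c])
qed

section \<open>Equivariance under a symmetry\<close>

context
  fixes p :: "'p::finite \<Rightarrow> real^2" and e :: "'b::finite \<Rightarrow> 'p set" and m :: "'m::finite \<Rightarrow> 'p \<times> 'b"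
    and T :: "real^2 \<Rightarrow> real^2"
  assumes framework: "body_framework p e m" and symmetry: "T \<in> spatial_group p e"
begin

lemma orthogonal_transformation_rho_sp: "orthogonal_transformation ((*v) (rho_sp T))"
  and rho_sp_eq: "rho_sp T *v x = T x - T 0"
proof -
  have *: "orthogonal_transformation (\<lambda>x. T x - T 0)"
    using symmetry by (auto simp: spatial_group_def orthogonal_transformation_isometry dist_norm)
  then show eq: "rho_sp T *v x = T x - T 0" for x
    unfolding rho_sp_def by (simp add: matrix_works orthogonal_transformation_linear)
  then show "orthogonal_transformation ((*v) (rho_sp T))"
    using * by (metis (no_types, lifting) ext)
qed

lemma rho_sp_rot90: "rho_sp T *v rot90 x = det (rho_sp T) *\<^sub>R rot90 (rho_sp T *v x)"
  using orthogonal_transformation_rho_sp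
  by (intro orthogonal_matrix_rot90) (metis matrix_of_matrix_vector_mul orthogonal_transformation_matrix)

text \<open>On the angular coordinate \<open>rho_sp_plus T\<close> is multiplication by \<open>det (rho_sp T)\<close>, which is \<open>\<plusminus>1\<close>.\<close>

lemma orthogonal_transformation_rho_sp_plus: "orthogonal_transformation ((*v) (rho_sp_plus T))"
proof -
  have "det (rho_sp T) * det (rho_sp T) = 1"
    using orthogonal_transformation_rho_sp orthogonal_transformation_det
    by (metis abs_mult_self_eq matrix_of_matrix_vector_mul mult_1)
  then have "(rho_sp_plus T *v v) \<bullet> (rho_sp_plus T *v w) = v \<bullet> w" for v w
    using orthogonal_transformation_rho_sp
    by (simp add: inner_translation_part translation_part_rho_sp_plus angular_rho_sp_plus
        orthogonal_transformation_def)
  then show ?thesis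
    by (simp add: orthogonal_transformation_def)
qed

lemma bij_pin_perm: "bij (pin_perm p T)"
  and pin_perm: "T (p i) = p (pin_perm p T i)"
  and bij_body_perm: "bij (body_perm p e T)"
  and body_perm: "pin_perm p T ` e j = e (body_perm p e T j)"
proof -
  obtain \<pi> \<tau> where \<pi>\<tau>: "bij \<pi>" "bij \<tau>" "\<And>i. T (p i) = p (\<pi> i)" "\<And>j. \<pi> ` e j = e (\<tau> j)"
    using symmetry by (auto simp: spatial_group_def)
  have inj: "inj p" "inj e"
    using framework by (auto simp: body_framework_def)
  have pi: "pin_perm p T = \<pi>"
    unfolding pin_perm_def using \<pi>\<tau> inj by (intro the_equality) (auto simp: fun_eq_iff inj_eq)
  have tau: "body_perm p e T = \<tau>"
    unfolding body_perm_def pi using \<pi>\<tau> inj by (intro the_equality) (auto simp: fun_eq_iff inj_eq)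
  show "bij (pin_perm p T)" "T (p i) = p (pin_perm p T i)"
    "bij (body_perm p e T)" "pin_perm p T ` e j = e (body_perm p e T j)"
    using \<pi>\<tau> pi tau by simp_all
qed

text \<open>If the pin \<open>i\<close> belongs to the body \<open>j\<close>, then its image belongs to the image of \<open>j\<close> by
  \<open>body_perm\<close>, so the image of a membership pair has a number under \<open>m\<close>.\<close>

lemma bij_mem_perm: "bij (mem_perm p e m T)"
  and mem_perm: "m (mem_perm p e m T k) = (pin_perm p T (fst (m k)), body_perm p e T (snd (m k)))"
proof -
  let ?\<phi> = "\<lambda>k. (pin_perm p T (fst (m k)), body_perm p e T (snd (m k)))"
  have m: "inj m" "range m = {(i, j). i \<in> e j}"
    using framework by (auto simp: body_framework_def bij_betw_def)
  have "?\<phi> k \<in> range m" for k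
  proof -
    have "m k \<in> {(i, j). i \<in> e j}"
      unfolding m(2)[symmetric] by (rule rangeI)
    then have "pin_perm p T (fst (m k)) \<in> e (body_perm p e T (snd (m k)))"
      unfolding body_perm[symmetric] by (auto simp: case_prod_unfold)
    then show ?thesis
      unfolding m(2) by simp
  qed
  then have "\<forall>k. \<exists>l. m l = ?\<phi> k"
    unfolding image_iff by metis
  then have \<mu>: "\<exists>\<mu>. \<forall>k. m (\<mu> k) = ?\<phi> k"
    by (rule choice)
  have "\<exists>!\<mu>. \<forall>k. m (\<mu> k) = ?\<phi> k"
  proof (rule ex_ex1I[OF \<mu>])
    fix \<mu> \<mu>' assume "\<forall>k. m (\<mu> k) = ?\<phi> k" "\<forall>k. m (\<mu>' k) = ?\<phi> k"
    then have "m (\<mu> k) = m (\<mu>' k)" for k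
      by simp
    then show "\<mu> = \<mu>'"
      using m(1) by (auto simp: inj_eq)
  qed
  then have mp: "\<forall>k. m (mem_perm p e m T k) = ?\<phi> k"
    unfolding mem_perm_def by (rule theI')
  then show "m (mem_perm p e m T k) = ?\<phi> k"
    by blast
  have "inj (mem_perm p e m T)"
  proof (rule injI)
    fix k l assume "mem_perm p e m T k = mem_perm p e m T l"
    then have "?\<phi> k = ?\<phi> l"
      using mp by metis
    then have "m k = m l"
      using bij_pin_perm bij_body_perm by (auto simp: bij_is_inj inj_eq prod_eq_iff)
    then show "k = l"
      using m(1) by (simp add: inj_eq)
  qed
  then show "bij (mem_perm p e m T)"
    by (simp add: bij_def finite_UNIV_inj_surj)
qed

text \<open>\<open>T\<close> is affine, so it commutes with the formation of barycentres.\<close>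

lemma centroid_body_perm: "T (centroid p e j) = centroid p e (body_perm p e T j)"
proof -
  let ?A = "rho_sp T"
  have inj: "inj_on (pin_perm p T) (e j)"
    using bij_pin_perm by (meson bij_is_inj inj_on_subset subset_UNIV)
  have "card (e j) \<noteq> 0"
    using framework by (auto simp: body_framework_def dest: spec[of _ j])
  have "(\<Sum>i\<in>e (body_perm p e T j). p i) = (\<Sum>i\<in>e j. T (p i))"
    using inj by (simp add: sum.reindex pin_perm flip: body_perm)
  also have "\<dots> = (\<Sum>i\<in>e j. ?A *v p i + T 0)"
    by (simp add: rho_sp_eq)
  also have "\<dots> = ?A *v (\<Sum>i\<in>e j. p i) + real (card (e j)) *\<^sub>R T 0"
    by (simp add: sum.distrib linear_sum[OF matrix_vector_mul_linear] scaleR_conv_of_real sum_constant_scaleR)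
  finally have "centroid p e (body_perm p e T j) = ?A *v centroid p e j + T 0"
    using \<open>card (e j) \<noteq> 0\<close> inj
    by (simp add: centroid_def card_image scaleR_add_right matrix_vector_mult_scaleR flip: body_perm)
  then show ?thesis
    by (simp add: rho_sp_eq)
qed

lemma rho_dom_pin: "snd (rho_dom p e T (v, u)) $ pin_perm p T i = rho_sp T *v (u $ i)"
  and rho_dom_body: "translation_part (fst (rho_dom p e T (v, u)) $ body_perm p e T j)
      = rho_sp T *v translation_part (v $ j)"
  and rho_dom_angular: "fst (rho_dom p e T (v, u)) $ body_perm p e T j $ 3 = det (rho_sp T) * v $ j $ 3"
  using bij_pin_perm bij_body_perm
  by (simp_all add: rho_dom_def rho_pin_def rho_body_def tensor_op_perm_mat bij_is_inj
      translation_part_rho_sp_plus angular_rho_sp_plus)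

lemma orthogonal_transformation_rho_dom: "orthogonal_transformation (rho_dom p e T)"
proof -
  have "orthogonal_transformation (tensor_op (rho_body p e T) (rho_sp_plus T))"
    "orthogonal_transformation (tensor_op (rho_pin p T) (rho_sp T))"
    unfolding rho_body_def rho_pin_def
    using bij_pin_perm bij_body_perm orthogonal_transformation_rho_sp orthogonal_transformation_rho_sp_plus
    by (simp_all add: orthogonal_transformation_tensor_op_perm_mat)
  then show ?thesis
    by (auto simp: rho_dom_def orthogonal_transformation_def linear_iff)
qed

lemma orthogonal_transformation_rho_codom: "orthogonal_transformation (rho_codom p e m T)"
  unfolding rho_codom_def rho_mem_def
  by (simp add: bij_mem_perm orthogonal_transformation_rho_sp orthogonal_transformation_tensor_op_perm_mat)

text \<open>The terms \<open>u\<^sub>i\<close> and \<open>v\<^sub>j\<close> are just moved and multiplied by the linear part \<open>A\<close> of \<open>T\<close>. In the rotational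
  term, \<open>a\<^sub>j\<close> acquires the factor \<open>det A\<close> and the arm \<open>p\<^sub>i - p\<^sub>e\<close> becomes its image under \<open>A\<close>; this is
  the effect of \<open>A\<close> on \<open>a\<^sub>j (p\<^sub>i - p\<^sub>e)\<^sup>\<pi>\<^sup>/\<^sup>2\<close> because \<open>A\<close> and the quarter turn commute up to the sign \<open>det A\<close>.\<close>

lemma rigidity_map_equivariant:
  "rigidity_map p e m (rho_dom p e T z) = rho_codom p e m T (rigidity_map p e m z)"
proof -
  obtain v u where z: "z = (v, u)"
    by (cases z)
  obtain v' u' where z': "rho_dom p e T (v, u) = (v', u')"
    by (cases "rho_dom p e T (v, u)")
  let ?A = "rho_sp T" and ?\<mu> = "mem_perm p e m T"
  have "rigidity_map p e m (v', u') $ ?\<mu> k = rho_codom p e m T (rigidity_map p e m (v, u)) $ ?\<mu> k" for k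
  proof -
    obtain i j where ij: "m k = (i, j)"
      by (cases "m k")
    let ?d = "p i - centroid p e j"
    have d: "p (pin_perm p T i) - centroid p e (body_perm p e T j) = ?A *v ?d"
      by (simp add: matrix_vector_mult_diff_distrib rho_sp_eq flip: pin_perm centroid_body_perm)
    have "rigidity_map p e m (v', u') $ ?\<mu> k
        = ?A *v (u $ i) - ?A *v translation_part (v $ j) - (det ?A * v $ j $ 3) *\<^sub>R rot90 (?A *v ?d)"
      using rho_dom_pin[of v u i] rho_dom_body[of v u j] rho_dom_angular[of v u j]
      by (simp add: rigidity_map_nth mem_perm ij z' d)
    also have "\<dots> = ?A *v (u $ i - translation_part (v $ j) - v $ j $ 3 *\<^sub>R rot90 ?d)"
      by (simp add: matrix_vector_mult_diff_distrib matrix_vector_mult_scaleR rho_sp_rot90 mult.commute)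
    also have "\<dots> = rho_codom p e m T (rigidity_map p e m (v, u)) $ ?\<mu> k"
      using bij_mem_perm
      by (simp add: rho_codom_def rho_mem_def tensor_op_perm_mat bij_is_inj rigidity_map_nth ij)
    finally show ?thesis .
  qed
  then show ?thesis
    unfolding z z' vec_eq_iff[where 'b='m] using bij_mem_perm by (metis bij_pointE)
qed

text \<open>A symmetry with linear part \<open>A\<close> conjugates a rigid motion \<open>x \<mapsto> b + \<omega> x\<^sup>\<pi>\<^sup>/\<^sup>2\<close> into another one: the angular velocity
  becomes \<open>det A \<omega>\<close>, and the translation is corrected for the image \<open>T 0\<close> of the origin.\<close>

lemma rho_dom_H_rig: "rho_dom p e T ` H_rig p e \<subseteq> H_rig p e"
proof (rule image_subsetI)
  fix z assume "z \<in> H_rig p e"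
  moreover obtain v u where z: "z = (v, u)"
    by (cases z)
  ultimately obtain b \<omega> where
    u: "\<And>i. u $ i = b + \<omega> *\<^sub>R rot90 (p i)" and
    v: "\<And>j. translation_part (v $ j) = b + \<omega> *\<^sub>R rot90 (centroid p e j)" "\<And>j. v $ j $ 3 = \<omega>"
    unfolding z mem_H_rig_iff by blast
  obtain v' u' where z': "rho_dom p e T (v, u) = (v', u')"
    by (cases "rho_dom p e T (v, u)")
  let ?A = "rho_sp T"
  \<comment> \<open>These constants make the next equation hold for all \<open>x\<close>, since \<open>?A *v x = T x - T 0\<close>.\<close>
  define \<omega>' where "\<omega>' = det ?A * \<omega>"
  define b' where "b' = ?A *v b - \<omega>' *\<^sub>R rot90 (T 0)"
  have A: "?A *v (b + \<omega> *\<^sub>R rot90 x) = b' + \<omega>' *\<^sub>R rot90 (T x)" for x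
  proof -
    have "rot90 (T x) = rot90 (?A *v x) + rot90 (T 0)"
      by (simp add: rho_sp_eq linear_diff[OF linear_rot90])
    then show ?thesis
      by (simp add: matrix_vector_right_distrib matrix_vector_mult_scaleR rho_sp_rot90
          b'_def \<omega>'_def algebra_simps)
  qed
  have "u' $ pin_perm p T i = b' + \<omega>' *\<^sub>R rot90 (p (pin_perm p T i))" for i
    using rho_dom_pin[of v u i] by (simp add: z' u A flip: pin_perm)
  then have "u' $ i = b' + \<omega>' *\<^sub>R rot90 (p i)" for i
    using bij_pin_perm by (metis bij_pointE)
  moreover have "translation_part (v' $ body_perm p e T j) = b' + \<omega>' *\<^sub>R rot90 (centroid p e (body_perm p e T j))
      \<and> v' $ body_perm p e T j $ 3 = \<omega>'" for j
    using rho_dom_body[of v u j] rho_dom_angular[of v u j]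
    by (simp add: z' v A \<omega>'_def flip: centroid_body_perm)
  then have "translation_part (v' $ j) = b' + \<omega>' *\<^sub>R rot90 (centroid p e j) \<and> v' $ j $ 3 = \<omega>'" for j
    using bij_body_perm by (metis bij_pointE)
  ultimately show "rho_dom p e T z \<in> H_rig p e"
    unfolding z z' mem_H_rig_iff by metis
qed

lemma trace_on_rho_dom:
  "trace_on UNIV (rho_dom p e T)
     = trace (rho_sp_plus T) * trace (rho_body p e T) + trace (rho_sp T) * trace (rho_pin p T)"
  unfolding rho_dom_def
  by (simp add: trace_on_prod linear_tensor_op sum_Basis_tensor_op mult.commute)

lemma trace_on_H_flex:
  "trace_on (H_flex p e m) (rho_dom p e T)
     = trace_on (H_rig p e) (rho_dom p e T) + trace_on (H_mech p e m) (rho_dom p e T)"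
proof -
  have "linear (rho_codom p e m T)"
    by (simp add: orthogonal_transformation_linear orthogonal_transformation_rho_codom)
  then have "rho_dom p e T ` H_flex p e m \<subseteq> H_flex p e m"
    by (auto simp: H_flex_def rigidity_map_equivariant linear_0)
  moreover have "subspace (H_flex p e m)"
    by (simp add: H_flex_def linear_subspace_kernel linear_rigidity_map)
  ultimately show ?thesis
    unfolding H_mech_def
    by (intro trace_on_orthogonal_comp orthogonal_transformation_rho_dom subspace_H_rig rho_dom_H_rig
        H_rig_subset_H_flex)
qed

end

section \<open>The character formula\<close>

theorem theorem4p5:
  fixes p :: "'p::finite \<Rightarrow> real^2"
    and e :: "'b::finite \<Rightarrow> 'p set"
    and m :: "'m::finite \<Rightarrow> 'p \<times> 'b"
  assumes "body_framework p e m"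
  shows "\<forall>T\<in>spatial_group p e.
     trace_on (H_mech p e m) (rho_dom p e T) - trace_on (H_st p e m) (rho_codom p e m T)
       = trace (rho_sp_plus T) * trace (rho_body p e T) + trace (rho_sp T) * trace (rho_pin p T)
         - trace_on UNIV (rho_codom p e m T) - trace_on (H_rig p e) (rho_dom p e T)"
proof
  fix T assume T: "T \<in> spatial_group p e"
  note sym = assms T
  have "trace_on (H_flex p e m) (rho_dom p e T) - trace_on (H_st p e m) (rho_codom p e m T)
      = trace_on UNIV (rho_dom p e T) - trace_on UNIV (rho_codom p e m T)"
    unfolding H_flex_def H_st_def
    by (intro trace_on_kernel_minus_cokernel linear_rigidity_map orthogonal_transformation_rho_dom[OF sym]
        orthogonal_transformation_rho_codom[OF sym] rigidity_map_equivariant[OF sym])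
  then show "trace_on (H_mech p e m) (rho_dom p e T) - trace_on (H_st p e m) (rho_codom p e m T)
       = trace (rho_sp_plus T) * trace (rho_body p e T) + trace (rho_sp T) * trace (rho_pin p T)
         - trace_on UNIV (rho_codom p e m T) - trace_on (H_rig p e) (rho_dom p e T)"
    using trace_on_rho_dom[OF sym] trace_on_H_flex[OF sym] by simp
qed

end
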